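(* Let $(E,\mathcal{E},\pi)$ be a $\sigma$-finite measured space, let $\lambda$ be the Lebesgue measure on $\mathbb{R}^+$, and let $U$ be a Poisson point process on $E\times\mathbb{R}^+\times\mathbb{R}^+$ of intensity $\pi\otimes\lambda\otimes\lambda$. Let $\mathcal{P}_\pi(E)$ be the set of all probability laws $p$ on $E$ admitting a density $f_p$ with respect to $\pi$. Then the formula $g(U,p)=x_{f_p}$ defines a global coupling for $\mathcal{P}_\pi(E)$ such that for every $p$ and $q$ in $\mathcal{P}_\pi(E)$, $$\mathbb{P}[g(U,p)\ne g(U,q)]\le\frac{2\|p-q\|}{1+\|p-q\|}\le 2\|p-q\|.$$
   Context: Global coupling: for a set $\mathcal{A}$ of probabilities on a measurable space $(E,\mathcal{E})$, a global coupling for $\mathcal{A}$ is a random variable $U$ with values in some measurable space $(F,\mathcal{F})$ together with a function $g$ from $F\times\mathcal{A}$ to $E$ such that for every $p\in\mathcal{A}$, $g(U,p)$ is a random variable of law $p$ on $E$ (here $g(U,p)$ is defined almost surely). Definition of $x_f$: $U$ is viewed as a random countable subset of $E\times\mathbb{R}^+\times\mathbb{R}^+$; an element $(x,y,t)$ of $U$ is seen as a point $(x,y)\in E\times\mathbb{R}^+$ appearing at time $t$. For a probability density $f$ on $(E,\mathcal{E},\pi)$, set $D_f=\{(x,y)\in E\times\mathbb{R}^+: y\le f(x)\}$ and $t_f=\inf\{t\ge 0: U\cap(D_f\times[0,t])\neq\emptyset\}$. Almost surely, $t_f$ is positive and finite and $U\cap(D_f\times[0,t_f])$ is reduced to a single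 point, denoted $(x_f,y_f,t_f)$. For $p,q\in\mathcal{P}_\pi(E)$, $\|p-q\|=\frac12\int_E|f_p-f_q|\,d\pi$ is the total variation distance. *)

theory Defs
  imports "HOL-Probability.Probability"
begin

definition num_points :: "'b set \<Rightarrow> 'b set \<Rightarrow> ennreal" where
  "num_points C A = emeasure (count_space UNIV) (C \<inter> A)"

text \<open>The measurable space of countable subsets of \<open>M\<close>, with the \<open>\<sigma>\<close>-algebra generated
  by the counting maps.\<close>

definition configurations :: "'b measure \<Rightarrow> 'b set measure" where
  "configurations M = sigma {C. C \<subseteq> space M \<and> countable C}
     {{C. C \<subseteq> space M \<and> countable C \<and> num_points C A \<in> B} | A B. A \<in> sets M \<and> B \<in> sets borel}"

text \<open>The third and fourth conditions say that \<open>num_points (U \<omega>) A\<close> has the Poisson law of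
  parameter \<open>M A\<close>; for parameter \<open>0\<close> the formula gives the point mass at \<open>0\<close> (as \<open>0 ^ 0 = 1\<close>),
  and the Poisson law of parameter \<open>\<infinity>\<close> is the point mass at \<open>\<infinity>\<close>.\<close>

definition poisson_point_process :: "'w measure \<Rightarrow> 'b measure \<Rightarrow> ('w \<Rightarrow> 'b set) \<Rightarrow> bool" where
  "poisson_point_process P M U \<longleftrightarrow>
     prob_space P \<and>
     U \<in> P \<rightarrow>\<^sub>M configurations M \<and>
     (\<forall>A\<in>sets M. emeasure M A < \<infinity> \<longrightarrow>
        (\<forall>k::nat. \<P>(\<omega> in P. num_points (U \<omega>) A = of_nat k)
           = exp (- measure M A) * measure M A ^ k / fact k)) \<and>
     (\<forall>A\<in>sets M. emeasure M A = \<infinity> \<longrightarrow> (AE \<omega> in P. num_points (U \<omega>) A = \<infinity>)) \<and>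
     (\<forall>(A :: nat \<Rightarrow> 'b set) n. (\<forall>i<n. A i \<in> sets M) \<and> disjoint_family_on A {..<n} \<longrightarrow>
        prob_space.indep_vars P (\<lambda>_. borel) (\<lambda>i \<omega>. num_points (U \<omega>) (A i)) {..<n})"

text \<open>A map \<open>g\<close> from \<open>F \<times> \<A>\<close> to \<open>E\<close> for which \<open>g(U, p)\<close> is only almost surely defined is
  rendered as an option-valued map. That \<open>g(U, p)\<close> is a random variable of law \<open>p\<close> then means
  that it is almost surely defined and equal to a measurable \<open>X\<close> of law \<open>p\<close>.\<close>

definition global_coupling ::
  "'w measure \<Rightarrow> 'f measure \<Rightarrow> 'a measure \<Rightarrow> 'a measure set \<Rightarrow>
     ('w \<Rightarrow> 'f) \<Rightarrow> ('f \<Rightarrow> 'a measure \<Rightarrow> 'a option) \<Rightarrow> bool" where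
  "global_coupling P F E \<A> U g \<longleftrightarrow>
     prob_space P \<and>
     U \<in> P \<rightarrow>\<^sub>M F \<and>
     (\<forall>p\<in>\<A>. \<exists>X. X \<in> P \<rightarrow>\<^sub>M E \<and> distr P E X = p \<and> (AE \<omega> in P. g (U \<omega>) p = Some (X \<omega>)))"

definition has_density :: "'a measure \<Rightarrow> 'a measure \<Rightarrow> ('a \<Rightarrow> real) \<Rightarrow> bool" where
  "has_density \<pi> p f \<longleftrightarrow>
     f \<in> borel_measurable \<pi> \<and> (\<forall>x\<in>space \<pi>. 0 \<le> f x) \<and> p = density \<pi> (\<lambda>x. ennreal (f x))"

definition density_laws :: "'a measure \<Rightarrow> 'a measure set" where
  "density_laws \<pi> = {p. prob_space p \<and> (\<exists>f. has_density \<pi> p f)}"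

definition tv_dist :: "'a measure \<Rightarrow> ('a \<Rightarrow> real) \<Rightarrow> ('a \<Rightarrow> real) \<Rightarrow> real" where
  "tv_dist \<pi> f h = 1 / 2 * (\<integral>x. \<bar>f x - h x\<bar> \<partial>\<pi>)"

abbreviation lborel_nonneg :: "real measure" where
  "lborel_nonneg \<equiv> restrict_space lborel {0..}"

text \<open>Points \<open>(x, y, t)\<close> are encoded as \<open>((x, y), t)\<close>.\<close>

definition intensity :: "'a measure \<Rightarrow> (('a \<times> real) \<times> real) measure" where
  "intensity \<pi> = (\<pi> \<Otimes>\<^sub>M lborel_nonneg) \<Otimes>\<^sub>M lborel_nonneg"

definition subgraph :: "'a measure \<Rightarrow> ('a \<Rightarrow> real) \<Rightarrow> ('a \<times> real) set" where
  "subgraph \<pi> f = {(x, y). x \<in> space \<pi> \<and> 0 \<le> y \<and> y \<le> f x}"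

text \<open>The infimum is taken in the extended reals, so that it is \<open>\<infinity>\<close> on the empty set.\<close>

definition first_time :: "'a measure \<Rightarrow> ('a \<Rightarrow> real) \<Rightarrow> (('a \<times> real) \<times> real) set \<Rightarrow> ereal" where
  "first_time \<pi> f C = Inf (ereal ` {t. 0 \<le> t \<and> C \<inter> (subgraph \<pi> f \<times> {0..t}) \<noteq> {}})"

definition first_points ::
  "'a measure \<Rightarrow> ('a \<Rightarrow> real) \<Rightarrow> (('a \<times> real) \<times> real) set \<Rightarrow> (('a \<times> real) \<times> real) set" where
  "first_points \<pi> f C = C \<inter> (subgraph \<pi> f \<times> {s. 0 \<le> s \<and> ereal s \<le> first_time \<pi> f C})"

definition first_x :: "'a measure \<Rightarrow> ('a \<Rightarrow> real) \<Rightarrow> (('a \<times> real) \<times> real) set \<Rightarrow> 'a option" where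
  "first_x \<pi> f C =
     (if 0 < first_time \<pi> f C \<and> first_time \<pi> f C < \<infinity> \<and> is_singleton (first_points \<pi> f C)
      then Some (fst (fst (the_elem (first_points \<pi> f C)))) else None)"

end

theory Submission
  imports Defs "HOL-Real_Asymp.Real_Asymp"
begin

text \<open>
  If \<open>D\<^sub>1\<close> and \<open>D\<^sub>2\<close> are disjoint regions of measure \<open>a\<close> and \<open>b\<close>, their first arrival times are independent
  exponential variables of rates \<open>a\<close> and \<open>b\<close>, so \<open>D\<^sub>1\<close> is hit first with probability \<open>a / (a + b)\<close>; only
  the lower bound is needed, and it comes from cutting time into cells of length \<open>1 / n\<close> and letting
  \<open>n\<close> tend to infinity.
  A union bound over the same cells shows that almost surely no two points of a region of finite
  measure arrive at the same time, so \<open>x\<^sub>f\<close> is well defined.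
  Splitting the subgraph \<open>D\<^sub>f\<close> over \<open>A\<close> and over its complement, the lower bounds for both parts sum
  to \<open>1\<close>, which determines the law of \<open>x\<^sub>f\<close>. For the coupling bound, if the first point in
  \<open>D\<^sub>f \<union> D\<^sub>h\<close> falls in \<open>D\<^sub>f \<inter> D\<^sub>h\<close> then \<open>x\<^sub>f = x\<^sub>h\<close>; with \<open>d\<close> the total variation distance, these regions
  have measure \<open>1 + d\<close> and \<open>1 - d\<close>.
\<close>

section \<open>Counting points and Lebesgue measure on the half-line\<close>

lemma num_points_eq_0_iff: "num_points C A = 0 \<longleftrightarrow> C \<inter> A = {}"
  by (simp add: num_points_def emeasure_count_space_eq_0)

text \<open>An infinite set has count \<infinity>, so the bound forces finiteness first; only then
  is the count a cardinality.\<close>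

lemma num_points_less_2D:
  assumes "num_points C A < 2"
  shows "finite (C \<inter> A)" and "\<And>x y. x \<in> C \<inter> A \<Longrightarrow> y \<in> C \<inter> A \<Longrightarrow> x = y"
proof -
  show fin: "finite (C \<inter> A)"
    using assms by (rule contrapos_pp) (simp add: num_points_def)
  then have "ennreal (of_nat (card (C \<inter> A))) < ennreal (of_nat 2)"
    using assms by (simp add: num_points_def ennreal_of_nat_eq_real_of_nat)
  then have "card (C \<inter> A) < 2"
    by (subst (asm) ennreal_less_iff) auto
  then show "x = y" if "x \<in> C \<inter> A" "y \<in> C \<inter> A" for x y
    using that fin card_le_Suc0_iff_eq[of "C \<inter> A"] by auto
qed

lemma space_configurations: "space (configurations M) = {C. C \<subseteq> space M \<and> countable C}"
  unfolding configurations_def by (rule space_measure_of) blast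

lemma sigma_finite_lborel_nonneg: "sigma_finite_measure lborel_nonneg"
  by (intro sigma_finite_measure_restrict_space sigma_finite_lborel) auto

lemma sets_lborel_nonneg_iff: "A \<in> sets lborel_nonneg \<longleftrightarrow> A \<subseteq> {0..} \<and> A \<in> sets borel"
  by (subst sets_restrict_space_iff) auto

lemma emeasure_lborel_nonneg: "A \<subseteq> {0..} \<Longrightarrow> emeasure lborel_nonneg A = emeasure lborel A"
  by (rule emeasure_restrict_space) auto

lemma emeasure_Times_lborel_nonneg:
  assumes "D \<in> sets N" "A \<in> sets lborel_nonneg"
  shows "emeasure (N \<Otimes>\<^sub>M lborel_nonneg) (D \<times> A) = emeasure N D * emeasure lborel A"
  using assms
  by (simp add: sigma_finite_measure.emeasure_pair_measure_Times[OF sigma_finite_lborel_nonneg]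
      sets_lborel_nonneg_iff emeasure_lborel_nonneg)

text \<open>Rational times make this a measurable event.\<close>

definition precedes :: "('b \<times> real) set \<Rightarrow> 'b set \<Rightarrow> 'b set \<Rightarrow> bool" where
  "precedes C D1 D2 \<longleftrightarrow> 
    (\<exists>s::rat. 0 \<le> s \<and> C \<inter> (D1 \<times> {0..of_rat s}) \<noteq> {} \<and> C \<inter> (D2 \<times> {0..of_rat s}) = {})"

section \<open>Poisson processes with a time coordinate: counts and independence\<close>

locale timed_poisson_process =
  fixes P :: "'w measure" and N :: "'b measure" and U :: "'w \<Rightarrow> ('b \<times> real) set"
  assumes poisson: "poisson_point_process P (N \<Otimes>\<^sub>M lborel_nonneg) U"

sublocale timed_poisson_process \<subseteq> prob_space P
  using poisson by (simp add: poisson_point_process_def)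

context timed_poisson_process
begin

abbreviation intens :: "('b \<times> real) measure" where
  "intens \<equiv> N \<Otimes>\<^sub>M lborel_nonneg"

lemma measurable_process: "U \<in> P \<rightarrow>\<^sub>M configurations intens"
  using poisson by (simp add: poisson_point_process_def)

lemma measurable_num_points [measurable]:
  assumes A: "A \<in> sets intens"
  shows "(\<lambda>\<omega>. num_points (U \<omega>) A) \<in> borel_measurable P"
proof (rule measurableI)
  fix B :: "ennreal set" assume B: "B \<in> sets borel"
  let ?S = "{C. C \<subseteq> space intens \<and> countable C \<and> num_points C A \<in> B}"
  have "?S \<in> sets (configurations intens)"
    using A B unfolding configurations_def
    by (subst sets_measure_of) (blast intro: sigma_sets.Basic)+
  from measurable_sets[OF measurable_process this]
  show "(\<lambda>\<omega>. num_points (U \<omega>) A) -` B \<inter> space P \<in> sets P"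
    \<comment> \<open>The preimage of \<open>?S\<close> under \<open>U\<close> is the wanted one
      because \<open>U\<close> takes its values in the countable subsets of the space.\<close>
    by (rule back_subst[where P="\<lambda>S. S \<in> sets P"])
      (use measurable_space[OF measurable_process] in \<open>auto simp: space_configurations\<close>)
qed auto

lemma pred_empty [measurable]:
  "A \<in> sets intens \<Longrightarrow> Measurable.pred P (\<lambda>\<omega>. U \<omega> \<inter> A = {})"
  unfolding num_points_eq_0_iff[symmetric] pred_def
  by (intro borel_measurable_eq measurable_num_points) auto

lemma prob_num_points:
  assumes "A \<in> sets intens" "emeasure intens A = ennreal a" "0 \<le> a"
  shows "\<P>(\<omega> in P. num_points (U \<omega>) A = of_nat k) = exp (- a) * a ^ k / fact k"
  using poisson assms unfolding poisson_point_process_def by (auto simp: measure_def)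

lemma prob_empty:
  assumes "A \<in> sets intens" "emeasure intens A = ennreal a" "0 \<le> a"
  shows "\<P>(\<omega> in P. U \<omega> \<inter> A = {}) = exp (- a)"
  using prob_num_points[OF assms, of 0] by (simp add: num_points_eq_0_iff)

text \<open>The exact probability 1 - (1 + a) exp (- a) is bounded using exp (- a) \<ge> 1 - a. The
  quadratic order in \<open>a\<close> is what later makes a union bound over many small cells vanish
  in the limit.\<close>

lemma prob_ge_2:
  assumes [measurable]: "A \<in> sets intens" and a: "emeasure intens A = ennreal a" "0 \<le> a"
  shows "\<P>(\<omega> in P. \<not> num_points (U \<omega>) A < 2) \<le> a\<^sup>2"
proof -
  let ?E = "\<lambda>k. {\<omega> \<in> space P. num_points (U \<omega>) A = of_nat k}"
  have E: "?E k \<in> events" for k by measurable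
  have "\<P>(\<omega> in P. \<not> num_points (U \<omega>) A < 2) \<le> prob (space P - (?E 0 \<union> ?E 1))"
    using E by (intro finite_measure_mono) auto
  also have "\<dots> = 1 - (prob (?E 0) + prob (?E 1))"
    using E by (subst prob_compl, force, subst finite_measure_Union) auto
  also have "\<dots> = 1 - (1 + a) * exp (- a)"
    using prob_num_points[OF assms, of 0] prob_num_points[OF assms, of 1]
    by (simp add: algebra_simps)
  also have "\<dots> \<le> 1 - (1 + a) * (1 - a)"
    using a exp_ge_add_one_self[of "- a"] by (intro diff_left_mono mult_left_mono) auto
  finally show ?thesis by (simp add: power2_eq_square algebra_simps)
qed

lemma prob_indep_cells:
  assumes sets: "A \<in> sets intens" "B \<in> sets intens" "C \<in> sets intens"
    and disj: "A \<inter> B = {}" "A \<inter> C = {}" "B \<inter> C = {}"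
    and a: "emeasure intens A = ennreal a" "0 \<le> a"
    and b: "emeasure intens B = ennreal b" "0 \<le> b"
    and c: "emeasure intens C = ennreal c" "0 \<le> c"
  shows "\<P>(\<omega> in P. U \<omega> \<inter> A = {} \<and> U \<omega> \<inter> B \<noteq> {} \<and> U \<omega> \<inter> C = {})
    = exp (- a) * (1 - exp (- b)) * exp (- c)"
proof -
  \<comment> \<open>Independence is stated for families over an initial segment of the naturals, so
    the three regions become \<open>D 0\<close>, \<open>D 1\<close>, \<open>D 2\<close>. A count in
    \<open>V 1\<close>, the complement of 0, expresses that \<open>B\<close> is hit.\<close>
  define D where "D i = (if i = 0 then A else if i = 1 then B else C)" for i :: nat
  define V where "V i = (if i = 1 then - {0} else {0} :: ennreal set)" for i :: nat
  have three: "{..<3} = {0, 1, 2::nat}" by auto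
  have "(\<forall>i<3. D i \<in> sets intens) \<and> disjoint_family_on D {..<3}"
    using sets disj by (auto simp: D_def disjoint_family_on_def)
  then have "indep_vars (\<lambda>_. borel) (\<lambda>i \<omega>. num_points (U \<omega>) (D i)) {..<3}"
    using poisson unfolding poisson_point_process_def by blast
  from indep_varsD[OF this, of "{..<3}" V]
  have "prob (\<Inter>i\<in>{..<3}. (\<lambda>\<omega>. num_points (U \<omega>) (D i)) -` V i \<inter> space P)
      = (\<Prod>i<3. prob ((\<lambda>\<omega>. num_points (U \<omega>) (D i)) -` V i \<inter> space P))"
    by (auto simp: V_def three)
  moreover have "(\<Inter>i\<in>{..<3}. (\<lambda>\<omega>. num_points (U \<omega>) (D i)) -` V i \<inter> space P)
      = {\<omega> \<in> space P. U \<omega> \<inter> A = {} \<and> U \<omega> \<inter> B \<noteq> {} \<and> U \<omega> \<inter> C = {}}"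
    by (auto simp: three D_def V_def num_points_eq_0_iff)
  moreover have "(\<lambda>\<omega>. num_points (U \<omega>) (D 0)) -` V 0 \<inter> space P = {\<omega> \<in> space P. U \<omega> \<inter> A = {}}"
    "(\<lambda>\<omega>. num_points (U \<omega>) (D 1)) -` V 1 \<inter> space P = space P - {\<omega> \<in> space P. U \<omega> \<inter> B = {}}"
    "(\<lambda>\<omega>. num_points (U \<omega>) (D 2)) -` V 2 \<inter> space P = {\<omega> \<in> space P. U \<omega> \<inter> C = {}}"
    by (auto simp: D_def V_def num_points_eq_0_iff)
  moreover have "prob (space P - {\<omega> \<in> space P. U \<omega> \<inter> B = {}}) = 1 - exp (- b)"
    using sets b by (subst prob_compl) (auto simp: prob_empty)
  ultimately show ?thesis
    using sets a c by (simp add: three prob_empty)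
qed

section \<open>The race between two disjoint regions\<close>

lemma sets_Times_interval [measurable]:
  assumes "D \<in> sets N" "0 \<le> s"
  shows "D \<times> {s..t} \<in> sets intens" and "D \<times> {s<..t} \<in> sets intens"
  using assms by (auto intro!: pair_measureI simp: sets_lborel_nonneg_iff)

lemma emeasure_Times:
  assumes "D \<in> sets N" "emeasure N D = ennreal d" "0 \<le> d" "0 \<le> s" "s \<le> t"
  shows "emeasure intens (D \<times> {s..t}) = ennreal (d * (t - s))"
    and "emeasure intens (D \<times> {s<..t}) = ennreal (d * (t - s))"
  using assms by (subst emeasure_Times_lborel_nonneg;
      force simp: sets_lborel_nonneg_iff ennreal_mult)+

lemma pred_precedes [measurable]:
  assumes "D1 \<in> sets N" "D2 \<in> sets N"
  shows "Measurable.pred P (\<lambda>\<omega>. precedes (U \<omega>) D1 D2)"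
proof -
  have [measurable]: "D1 \<times> {0..s} \<in> sets intens" "D2 \<times> {0..s} \<in> sets intens" for s :: real
    using assms by auto
  show ?thesis
    unfolding precedes_def by measurable
qed

text \<open>On the grid of mesh 1 / n, \<open>E k\<close> says that neither region is hit up to k /
  n and that only \<open>D1\<close> is hit in the next cell. These events are disjoint, each makes
  \<open>D1\<close> come first, and their probabilities form a geometric series whose sum tends to a
  / (a + b). Cells where both regions are hit are discarded, so each grid yields only a lower
  bound.\<close>

lemma prob_precedes_ge:
  assumes D: "D1 \<in> sets N" "D2 \<in> sets N" "D1 \<inter> D2 = {}"
    and a: "emeasure N D1 = ennreal a" "0 \<le> a"
    and b: "emeasure N D2 = ennreal b" "0 \<le> b" and ab: "0 < a + b"
  shows "a / (a + b) \<le> \<P>(\<omega> in P. precedes (U \<omega>) D1 D2)"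
proof (rule LIMSEQ_le_const2)
  show "(\<lambda>n. (1 - exp (- (a / real n))) * exp (- (b / real n)) / (1 - exp (- ((a + b) / real n))))
      \<longlonglongrightarrow> a / (a + b)"
  \<comment> \<open>For a = 0 both the sequence and the limit are 0; the asymptotic expansion treats
    a > 0.\<close>
  proof (cases "a = 0")
    case False
    with a have "0 < a" by simp
    with ab have "(\<lambda>n. (1 - exp (- (a / real n))) * exp (- (b / real n)) / (1 - exp (- ((a + b) / real n))))
      \<longlonglongrightarrow> a * inverse (b + a)" by real_asymp
    then show ?thesis by (simp add: divide_inverse add.commute)
  qed simp
  show "\<exists>m. \<forall>n\<ge>m. (1 - exp (- (a / real n))) * exp (- (b / real n)) / (1 - exp (- ((a + b) / real n)))
      \<le> \<P>(\<omega> in P. precedes (U \<omega>) D1 D2)"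
  proof (intro exI allI impI)
    \<comment> \<open>The threshold \<open>m\<close> is 1, which makes 1 / n a genuine mesh.\<close>
    fix n :: nat assume "1 \<le> n"
    then have n: "0 < real n" by simp
    define t where "t k = real k / real n" for k
    define E where "E k = {\<omega> \<in> space P. U \<omega> \<inter> ((D1 \<union> D2) \<times> {0..t k}) = {}
      \<and> U \<omega> \<inter> (D1 \<times> {t k<..t (Suc k)}) \<noteq> {} \<and> U \<omega> \<inter> (D2 \<times> {t k<..t (Suc k)}) = {}}" for k
    have t0: "0 \<le> t k" for k
      by (simp add: t_def)
    have t_mono: "t k \<le> t l" if "k \<le> l" for k l
      using that by (simp add: t_def divide_right_mono)
    have diff: "t (Suc k) - t k = 1 / real n" for k
      by (simp add: t_def diff_divide_distrib[symmetric])
    have meas: "(D1 \<union> D2) \<times> {0..t k} \<in> sets intens" "D1 \<times> {t k<..t (Suc k)} \<in> sets intens"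
      "D2 \<times> {t k<..t (Suc k)} \<in> sets intens" for k
      using D t0 by (auto intro!: sets_Times_interval)
    have E: "E k \<in> events" for k
      unfolding E_def using meas[of k] by measurable
    have D12: "D1 \<union> D2 \<in> sets N" "emeasure N (D1 \<union> D2) = ennreal (a + b)"
      using D a b by (simp_all add: plus_emeasure[symmetric])
    have probE: "prob (E k) = exp (- ((a + b) * t k)) * (1 - exp (- (a / real n))) * exp (- (b / real n))"
      for k
    proof -
      have "emeasure intens ((D1 \<union> D2) \<times> {0..t k}) = ennreal ((a + b) * t k)"
        "emeasure intens (D1 \<times> {t k<..t (Suc k)}) = ennreal (a / real n)"
        "emeasure intens (D2 \<times> {t k<..t (Suc k)}) = ennreal (b / real n)"
        using emeasure_Times(1)[OF D12, of 0 "t k"] emeasure_Times(2)[OF D(1) a, of "t k" "t (Suc k)"]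
          emeasure_Times(2)[OF D(2) b, of "t k" "t (Suc k)"] ab t0 t_mono[of k "Suc k"]
        by (auto simp: diff)
      then show ?thesis
        unfolding E_def using a b t0[of k] D
        by (intro prob_indep_cells meas) auto
    qed
    have "exp (- ((a + b) * t k)) = exp (- ((a + b) / real n)) ^ k" for k
      by (simp add: t_def exp_of_nat_mult[symmetric])
    then have "prob (E k) = ((1 - exp (- (a / real n))) * exp (- (b / real n))) * exp (- ((a + b) / real n)) ^ k"
      for k by (simp add: probE mult_ac)
    moreover have "(\<lambda>k. exp (- ((a + b) / real n)) ^ k) sums (1 / (1 - exp (- ((a + b) / real n))))"
      using ab n by (intro geometric_sums) auto
    ultimately have "(\<lambda>k. prob (E k)) sums
        (((1 - exp (- (a / real n))) * exp (- (b / real n))) * (1 / (1 - exp (- ((a + b) / real n)))))"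
      by (simp only: sums_mult)
    moreover have "disjoint_family E"
    proof -
      \<comment> \<open>\<open>E k\<close> puts a point of \<open>D1\<close> in the cell ending at
        \<open>t (Suc k)\<close>, whereas \<open>E l\<close> keeps \<open>D1\<close> empty up to
        \<open>t l\<close>, which is at least \<open>t (Suc k)\<close>.\<close>
      have "E k \<inter> E l = {}" if "k < l" for k l
      proof -
        have "D1 \<times> {t k<..t (Suc k)} \<subseteq> (D1 \<union> D2) \<times> {0..t l}"
          using that t0[of k] t_mono[of "Suc k" l] by auto
        then show ?thesis unfolding E_def by blast
      qed
      then show ?thesis
        unfolding disjoint_family_on_def by (metis Int_commute nat_neq_iff)
    qed
    then have "(\<lambda>k. prob (E k)) sums prob (\<Union>k. E k)"
      using E by (intro finite_measure_UNION) auto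
    ultimately have "((1 - exp (- (a / real n))) * exp (- (b / real n))) * (1 / (1 - exp (- ((a + b) / real n))))
        = prob (\<Union>k. E k)"
      by (rule sums_unique2)
    also have "\<dots> \<le> \<P>(\<omega> in P. precedes (U \<omega>) D1 D2)"
    proof (rule finite_measure_mono)
      show "{\<omega> \<in> space P. precedes (U \<omega>) D1 D2} \<in> events"
        using D by measurable
      show "(\<Union>k. E k) \<subseteq> {\<omega> \<in> space P. precedes (U \<omega>) D1 D2}"
      proof safe
        fix \<omega> k assume \<omega>: "\<omega> \<in> E k"
        then show "\<omega> \<in> space P" by (simp add: E_def)
        have "D1 \<times> {t k<..t (Suc k)} \<subseteq> D1 \<times> {0..t (Suc k)}"
          using t0[of k] by auto
        moreover have "D2 \<times> {0..t (Suc k)} \<subseteq> (D1 \<union> D2) \<times> {0..t k} \<union> D2 \<times> {t k<..t (Suc k)}"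
          by auto
        ultimately have "U \<omega> \<inter> (D1 \<times> {0..t (Suc k)}) \<noteq> {}" "U \<omega> \<inter> (D2 \<times> {0..t (Suc k)}) = {}"
          using \<omega> unfolding E_def by blast+
        \<comment> \<open>The witness is the grid time \<open>t (Suc k)\<close>, which is
          rational.\<close>
        then show "precedes (U \<omega>) D1 D2"
          unfolding precedes_def
          by (intro exI[of _ "of_nat (Suc k) / of_nat n"]) (simp add: t_def of_rat_divide of_rat_add)
      qed
    qed
    finally show "(1 - exp (- (a / real n))) * exp (- (b / real n)) / (1 - exp (- ((a + b) / real n)))
      \<le> \<P>(\<omega> in P. precedes (U \<omega>) D1 D2)"
      by simp
  qed
qed

end

section \<open>Almost sure regularity of the arrival times\<close>

text \<open>The three clauses make the first arrival time positive, finite, and attained by exactly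
  one point. Horizons are natural numbers so that the last clause is a countable conjunction, suited
  to almost sure statements.\<close>

definition well_timed :: "('b \<times> real) set \<Rightarrow> 'b set \<Rightarrow> bool" where
  "well_timed C D \<longleftrightarrow> C \<inter> (D \<times> {0}) = {} \<and> (\<exists>T. C \<inter> (D \<times> {0..T}) \<noteq> {}) \<and>
     (\<forall>T::nat. finite (C \<inter> (D \<times> {0..real T})) \<and> inj_on snd (C \<inter> (D \<times> {0..real T})))"

text \<open>The integer part of t * n indexes the cell. It equals T * n when t = T, which is why the
  range is \<open>Suc T * n\<close> instead of \<open>T * n\<close>.\<close>

lemma ex_grid_cell:
  fixes t :: real
  assumes "0 \<le> t" "t \<le> real T" "0 < n"
  shows "\<exists>k<Suc T * n. t \<in> {real k / real n..real (Suc k) / real n}"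
proof (intro exI conjI)
  let ?k = "nat \<lfloor>t * real n\<rfloor>"
  have k: "real ?k \<le> t * real n" "t * real n < real ?k + 1"
    using assms by (auto simp: of_nat_nat)
  have "t * real n \<le> real (T * n)"
    using assms by simp
  with k have "real ?k \<le> real (T * n)" by linarith
  then have "?k \<le> T * n" by (simp only: of_nat_le_iff)
  then show "?k < Suc T * n" using assms by simp
  show "t \<in> {real ?k / real n..real (Suc ?k) / real n}"
    using k assms by (simp add: field_simps)
qed

context timed_poisson_process
begin

text \<open>A cell has intensity d / n, so it holds two points with probability at most (d / n)^2.
  Summing over T * n cells gives T * d^2 / n, which tends to 0, so the event that every grid is bad
  is null.\<close>

lemma AE_grid_cells:
  assumes D: "D \<in> sets N" "emeasure N D = ennreal d" "0 \<le> d"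
  shows "AE \<omega> in P. \<exists>n>0. \<forall>k<T * n.
    num_points (U \<omega>) (D \<times> {real k / real n..real (Suc k) / real n}) < 2"
proof -
  let ?cell = "\<lambda>n k. D \<times> {real k / real n..real (Suc k) / real n}"
  define bad where "bad n = {\<omega> \<in> space P. \<exists>k<T * n. \<not> num_points (U \<omega>) (?cell n k) < 2}" for n
  have [measurable]: "?cell n k \<in> sets intens" for n k
    using D by (intro sets_Times_interval) auto
  have bad: "bad n \<in> events" for n
    unfolding bad_def by measurable
  have le: "prob (bad n) \<le> (real T * d\<^sup>2) / real n" if "0 < n" for n
  proof -
    have "emeasure intens (?cell n k) = ennreal (d / real n)" for k
      using emeasure_Times(1)[OF D, of "real k / real n" "real (Suc k) / real n"]
      by (simp add: divide_right_mono diff_divide_distrib[symmetric])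
    then have "\<P>(\<omega> in P. \<not> num_points (U \<omega>) (?cell n k) < 2) \<le> (d / real n)\<^sup>2" for k
      using D by (intro prob_ge_2) auto
    then have *: "(\<Sum>k<T * n. \<P>(\<omega> in P. \<not> num_points (U \<omega>) (?cell n k) < 2))
        \<le> (\<Sum>k<T * n. (d / real n)\<^sup>2)"
      by (rule sum_mono)
    have "bad n = (\<Union>k<T * n. {\<omega> \<in> space P. \<not> num_points (U \<omega>) (?cell n k) < 2})"
      by (auto simp: bad_def)
    also have "prob \<dots> \<le> (\<Sum>k<T * n. \<P>(\<omega> in P. \<not> num_points (U \<omega>) (?cell n k) < 2))"
      by (intro finite_measure_subadditive_finite image_subsetI) (simp, measurable)
    finally show ?thesis
      using * that by (simp add: power2_eq_square)
  qed
  \<comment> \<open>The index starts at 1: \<open>bad 0\<close> ranges over no cells and is empty,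
    so including it would make the intersection trivially empty without providing a grid with n >
    0.\<close>
  have "prob (\<Inter>n. bad (Suc n)) = 0"
  proof (rule antisym)
    have "(\<lambda>n. (real T * d\<^sup>2) / real (Suc n)) \<longlonglongrightarrow> 0"
      using lim_const_over_n[of "real T * d\<^sup>2"] by (rule LIMSEQ_Suc)
    moreover have "prob (\<Inter>n. bad (Suc n)) \<le> (real T * d\<^sup>2) / real (Suc n)" for n
      using le[of "Suc n"] finite_measure_mono[of "\<Inter>n. bad (Suc n)" "bad (Suc n)"] bad
      by force
    ultimately show "prob (\<Inter>n. bad (Suc n)) \<le> 0"
      by (intro LIMSEQ_le_const) auto
  qed simp
  moreover have "(\<Inter>n. bad (Suc n)) \<in> events"
    using bad by auto
  ultimately have "(\<Inter>n. bad (Suc n)) \<in> null_sets P"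
    by (simp add: emeasure_eq_measure null_sets_def)
  then have "AE \<omega> in P. \<omega> \<notin> (\<Inter>n. bad (Suc n))"
    by (rule AE_not_in)
  with AE_space show ?thesis
  proof eventually_elim
    case (elim \<omega>)
    then obtain n where "\<omega> \<notin> bad (Suc n)" by blast
    with elim(1) show ?case
      unfolding bad_def by (intro exI[of _ "Suc n"]) blast
  qed
qed

lemma AE_well_timed:
  assumes D: "D \<in> sets N" "emeasure N D = ennreal d" "0 < d"
  shows "AE \<omega> in P. well_timed (U \<omega>) D"
proof -
  have D': "0 \<le> d" using D by simp
  \<comment> \<open>A race against the empty region is won with probability d / (d + 0) = 1, so
    \<open>D\<close> is hit in finite time.\<close>
  have "prob {\<omega> \<in> space P. precedes (U \<omega>) D {}} = 1"
    using prob_precedes_ge[of D "{}" d 0] D by (intro antisym) auto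
  then have hit: "AE \<omega> in P. precedes (U \<omega>) D {}"
    using D by (subst (asm) prob_Collect_eq_1) auto
  \<comment> \<open>Time 0 is Lebesgue null, so the number of points arriving then is Poisson of
    parameter 0.\<close>
  have D0: "D \<times> {0} \<in> sets intens" "emeasure intens (D \<times> {0}) = ennreal 0"
    using sets_Times_interval(1)[of D 0 0] emeasure_Times(1)[OF D(1,2) D', of 0 0] D by simp_all
  have "prob {\<omega> \<in> space P. U \<omega> \<inter> (D \<times> {0}) = {}} = 1"
    using prob_empty[OF D0] by simp
  then have zero: "AE \<omega> in P. U \<omega> \<inter> (D \<times> {0}) = {}"
    using D0 by (subst (asm) prob_Collect_eq_1) auto
  have "AE \<omega> in P. \<forall>T. \<exists>n>0. \<forall>k<Suc T * n.
    num_points (U \<omega>) (D \<times> {real k / real n..real (Suc k) / real n}) < 2"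
    using AE_grid_cells[OF D(1,2) D'] by (subst AE_all_countable) blast
  with hit zero show ?thesis
  proof eventually_elim
    case (elim \<omega>)
    have "finite (U \<omega> \<inter> (D \<times> {0..real T})) \<and> inj_on snd (U \<omega> \<inter> (D \<times> {0..real T}))" for T
    proof -
      obtain n where n: "0 < n" and
        cell: "\<And>k. k < Suc T * n \<Longrightarrow>
          num_points (U \<omega>) (D \<times> {real k / real n..real (Suc k) / real n}) < 2"
        using elim(3) by metis
      have "U \<omega> \<inter> (D \<times> {0..real T})
          \<subseteq> (\<Union>k<Suc T * n. U \<omega> \<inter> (D \<times> {real k / real n..real (Suc k) / real n}))"
        using ex_grid_cell[of _ T n] n by fastforce
      moreover have "finite (\<Union>k<Suc T * n. U \<omega> \<inter> (D \<times> {real k / real n..real (Suc k) / real n}))"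
        using num_points_less_2D(1)[OF cell] by blast
      ultimately have "finite (U \<omega> \<inter> (D \<times> {0..real T}))"
        by (rule finite_subset)
      moreover have "z = w" if z: "z \<in> U \<omega> \<inter> (D \<times> {0..real T})"
        and w: "w \<in> U \<omega> \<inter> (D \<times> {0..real T})" and eq: "snd z = snd w" for z w
      proof -
        \<comment> \<open>Points with equal times share the cell of that time, and the cell holds at
          most one point.\<close>
        obtain k where k: "k < Suc T * n" "snd z \<in> {real k / real n..real (Suc k) / real n}"
          using ex_grid_cell[of "snd z" T n] n z by auto
        show ?thesis
          using z w k(2) eq by (intro num_points_less_2D(2)[OF cell[OF k(1)]]) (auto simp: mem_Times_iff)
      qed
      ultimately show ?thesis by (auto simp: inj_on_def)
    qed
    moreover have "U \<omega> \<inter> (D \<times> {0}) = {}" by fact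
    moreover have "\<exists>T. U \<omega> \<inter> (D \<times> {0..T}) \<noteq> {}"
      using elim(1) unfolding precedes_def by blast
    ultimately show ?case unfolding well_timed_def by blast
  qed
qed

end

section \<open>First points of a fixed configuration\<close>

text \<open>Up to a horizon where \<open>D\<close> has been hit there are finitely many points with
  distinct times, so the minimum is attained once. The gap after it, again from finiteness, leaves
  room for a rational time.\<close>

lemma well_timed_first_point:
  assumes "well_timed C D"
  obtains z where "z \<in> C" "fst z \<in> D" "0 < snd z"
    and "\<And>w. w \<in> C \<Longrightarrow> fst w \<in> D \<Longrightarrow> 0 \<le> snd w \<Longrightarrow> w = z \<or> snd z < snd w"
    and "\<exists>e>snd z. \<forall>w\<in>C. fst w \<in> D \<longrightarrow> 0 \<le> snd w \<longrightarrow> snd w < e \<longrightarrow> w = z"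
proof -
  obtain T0 where T0: "C \<inter> (D \<times> {0..T0}) \<noteq> {}"
    using assms unfolding well_timed_def by blast
  obtain T :: nat where T: "T0 < real T" using reals_Archimedean2 by blast
  define F where "F = C \<inter> (D \<times> {0..real T})"
  have "C \<inter> (D \<times> {0..T0}) \<subseteq> F" using T by (auto simp: F_def)
  with T0 have "F \<noteq> {}" by blast
  have F: "finite F" "inj_on snd F"
    using assms unfolding F_def well_timed_def by blast+
  define z where "z = arg_min_on snd F"
  have z: "z \<in> F" and z_min: "\<And>w. w \<in> F \<Longrightarrow> snd z \<le> snd w"
    using F(1) \<open>F \<noteq> {}\<close> by (auto simp: z_def intro: arg_min_if_finite arg_min_least)
  have first: "w = z \<or> snd z < snd w" if "w \<in> C" "fst w \<in> D" "0 \<le> snd w" for w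
  proof (cases "snd w \<le> real T")
    case True
    then have "w \<in> F" using that by (simp add: F_def mem_Times_iff)
    then show ?thesis using z_min[of w] F(2) z unfolding inj_on_def by fastforce
  next
    case False
    then show ?thesis using z by (auto simp: F_def)
  qed
  obtain S :: nat where S: "snd z < real S" using reals_Archimedean2 by blast
  define G where "G = C \<inter> (D \<times> {0..real S}) - {z}"
  have G: "finite G" using assms unfolding G_def well_timed_def by blast
  \<comment> \<open>Inserting \<open>real S\<close> keeps the minimum defined when \<open>G\<close>
    is empty and ensures that any point of \<open>D\<close> with time in [0, e) lies within the
    horizon defining \<open>G\<close>.\<close>
  define e where "e = Min (insert (real S) (snd ` G))"
  have "snd z < snd w" if "w \<in> G" for w
    using that first[of w] by (auto simp: G_def mem_Times_iff)
  then have "snd z < e"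
    using G S by (auto simp: e_def)
  moreover have "w = z" if "w \<in> C" "fst w \<in> D" "0 \<le> snd w" "snd w < e" for w
  proof (rule ccontr)
    assume "w \<noteq> z"
    have "e \<le> real S" using G by (simp add: e_def)
    with \<open>w \<noteq> z\<close> that have "w \<in> G" by (simp add: G_def mem_Times_iff)
    then have "e \<le> snd w" using G by (simp add: e_def)
    with that show False by simp
  qed
  moreover have "0 < snd z"
  proof (rule ccontr)
    assume "\<not> 0 < snd z"
    with z have "z \<in> C \<inter> (D \<times> {0})" by (auto simp: F_def mem_Times_iff)
    then show False using assms unfolding well_timed_def by blast
  qed
  ultimately show ?thesis
    using z first by (intro that[of z]) (auto simp: F_def mem_Times_iff)
qed

text \<open>The equivalence turns membership of the first mark in \<open>A\<close> into a race
  between the parts of the subgraph over \<open>A\<close> and off \<open>A\<close>, which is an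
  event whose probability can be bounded.\<close>

lemma first_x_well_timed:
  assumes "well_timed C (subgraph \<pi> f)"
  shows "\<exists>x\<in>space \<pi>. first_x \<pi> f C = Some x \<and> (\<forall>A.
    x \<in> A \<longleftrightarrow> precedes C (subgraph \<pi> f \<inter> A \<times> UNIV) (subgraph \<pi> f - A \<times> UNIV))"
proof -
  let ?D = "subgraph \<pi> f"
  obtain z where z: "z \<in> C" "fst z \<in> ?D" "0 < snd z"
    and first: "\<And>w. w \<in> C \<Longrightarrow> fst w \<in> ?D \<Longrightarrow> 0 \<le> snd w \<Longrightarrow> w = z \<or> snd z < snd w"
    and "\<exists>e>snd z. \<forall>w\<in>C. fst w \<in> ?D \<longrightarrow> 0 \<le> snd w \<longrightarrow> snd w < e \<longrightarrow> w = z"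
    using well_timed_first_point[OF assms] by blast
  then obtain e where e: "snd z < e"
    "\<And>w. w \<in> C \<Longrightarrow> fst w \<in> ?D \<Longrightarrow> 0 \<le> snd w \<Longrightarrow> snd w < e \<Longrightarrow> w = z"
    by blast
  \<comment> \<open>This is a closed half-line, so the infimum is attained at the time of
    \<open>z\<close>.\<close>
  have "{t. 0 \<le> t \<and> C \<inter> (?D \<times> {0..t}) \<noteq> {}} = {snd z..}"
  proof (intro equalityI subsetI)
    fix t assume "t \<in> {t. 0 \<le> t \<and> C \<inter> (?D \<times> {0..t}) \<noteq> {}}"
    then obtain w where "w \<in> C" "fst w \<in> ?D" "0 \<le> snd w" "snd w \<le> t"
      by (auto simp: mem_Times_iff)
    with first[of w] show "t \<in> {snd z..}" by auto
  next
    fix t assume "t \<in> {snd z..}"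
    with z have "0 \<le> t" "z \<in> C \<inter> (?D \<times> {0..t})" by (auto simp: mem_Times_iff)
    then show "t \<in> {t. 0 \<le> t \<and> C \<inter> (?D \<times> {0..t}) \<noteq> {}}" by blast
  qed
  then have time: "first_time \<pi> f C = ereal (snd z)"
    unfolding first_time_def by (intro antisym Inf_lower Inf_greatest) auto
  have "first_points \<pi> f C = {z}"
    unfolding first_points_def time using z first by (fastforce simp: mem_Times_iff)
  then have x: "first_x \<pi> f C = Some (fst (fst z))"
    using z(3) by (simp add: first_x_def time is_singleton_def)
  have "fst (fst z) \<in> A \<longleftrightarrow> precedes C (?D \<inter> A \<times> UNIV) (?D - A \<times> UNIV)" for A
  proof
    assume A: "fst (fst z) \<in> A"
    \<comment> \<open>At a rational time inside the gap, \<open>z\<close> is the only point of the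
      subgraph that has arrived.\<close>
    obtain s where s: "snd z < of_rat s" "of_rat s < e"
      using of_rat_dense[OF e(1)] by blast
    have "(0::real) < of_rat s" using s z by linarith
    then have "0 \<le> s" by (simp add: zero_less_of_rat_iff)
    moreover have "z \<in> C \<inter> ((?D \<inter> A \<times> UNIV) \<times> {0..of_rat s})"
      using z A s by (simp add: mem_Times_iff)
    moreover have "C \<inter> ((?D - A \<times> UNIV) \<times> {0..of_rat s}) = {}"
      using e(2) s(2) A by (force simp: mem_Times_iff)
    ultimately show "precedes C (?D \<inter> A \<times> UNIV) (?D - A \<times> UNIV)"
      unfolding precedes_def by blast
  next
    assume "precedes C (?D \<inter> A \<times> UNIV) (?D - A \<times> UNIV)"
    then obtain s where "C \<inter> ((?D \<inter> A \<times> UNIV) \<times> {0..of_rat s}) \<noteq> {}"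
      and none: "C \<inter> ((?D - A \<times> UNIV) \<times> {0..of_rat s}) = {}"
      unfolding precedes_def by blast
    then obtain w where "w \<in> C" "fst w \<in> ?D" "0 \<le> snd w" "snd w \<le> of_rat s"
      by (auto simp: mem_Times_iff)
    with first[of w] have "snd z \<le> of_rat s" by auto
    moreover have "z \<notin> (?D - A \<times> UNIV) \<times> {0..of_rat s}"
      using none z(1) by blast
    ultimately show "fst (fst z) \<in> A"
      using z by (auto simp: mem_Times_iff)
  qed
  moreover have "fst (fst z) \<in> space \<pi>"
    using z(2) by (auto simp: subgraph_def)
  ultimately show ?thesis using x by blast
qed

lemma first_time_le:
  assumes "0 \<le> s" "C \<inter> (subgraph \<pi> f \<times> {0..s}) \<noteq> {}"
  shows "first_time \<pi> f C \<le> ereal s"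
  unfolding first_time_def using assms by (intro Inf_lower) blast

text \<open>Up to the time \<open>s\<close> at which the intersection has been hit and the symmetric
  difference has not, the two subgraphs contain the same arrivals, and both first times are at most
  \<open>s\<close>. Hence first times and first points agree, whatever happens later and even if
  both values are \<open>None\<close>.\<close>

lemma first_x_eq_of_precedes:
  assumes "precedes C (subgraph \<pi> f \<inter> subgraph \<pi> h)
    (subgraph \<pi> f \<union> subgraph \<pi> h - subgraph \<pi> f \<inter> subgraph \<pi> h)"
  shows "first_x \<pi> f C = first_x \<pi> h C"
proof -
  obtain s :: real where s: "0 \<le> s"
    and hit: "C \<inter> ((subgraph \<pi> f \<inter> subgraph \<pi> h) \<times> {0..s}) \<noteq> {}"
    and none: "C \<inter> ((subgraph \<pi> f \<union> subgraph \<pi> h - subgraph \<pi> f \<inter> subgraph \<pi> h) \<times> {0..s}) = {}"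
    using assms unfolding precedes_def by (metis zero_le_of_rat_iff)
  have agree: "fst z \<in> subgraph \<pi> f \<longleftrightarrow> fst z \<in> subgraph \<pi> h"
    if "z \<in> C" "0 \<le> snd z" "snd z \<le> s" for z
  proof -
    have "z \<notin> (subgraph \<pi> f \<union> subgraph \<pi> h - subgraph \<pi> f \<inter> subgraph \<pi> h) \<times> {0..s}"
      using none that(1) by blast
    then show ?thesis using that by (auto simp: mem_Times_iff)
  qed
  \<comment> \<open>Stated for arbitrary \<open>f'\<close> and \<open>h'\<close> so that it can be
    applied in both directions.\<close>
  have le: "first_time \<pi> f' C \<le> first_time \<pi> h' C"
    if agree': "\<And>z. z \<in> C \<Longrightarrow> 0 \<le> snd z \<Longrightarrow> snd z \<le> s \<Longrightarrow>
        fst z \<in> subgraph \<pi> f' \<longleftrightarrow> fst z \<in> subgraph \<pi> h'"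
      and hit': "C \<inter> (subgraph \<pi> f' \<times> {0..s}) \<noteq> {}" for f' h'
    unfolding first_time_def[of _ h']
  proof (rule Inf_greatest)
    fix u assume "u \<in> ereal ` {t. 0 \<le> t \<and> C \<inter> (subgraph \<pi> h' \<times> {0..t}) \<noteq> {}}"
    then obtain t where u: "u = ereal t" and t: "0 \<le> t" and "C \<inter> (subgraph \<pi> h' \<times> {0..t}) \<noteq> {}"
      by blast
    then obtain z where z: "z \<in> C" "fst z \<in> subgraph \<pi> h'" "0 \<le> snd z" "snd z \<le> t"
      by (auto simp: mem_Times_iff)
    show "first_time \<pi> f' C \<le> u"
      unfolding u
    proof (cases "t \<le> s")
      case True
      then have "z \<in> C \<inter> (subgraph \<pi> f' \<times> {0..t})"
        using agree'[OF z(1)] z by (auto simp: mem_Times_iff)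
      with t show "first_time \<pi> f' C \<le> ereal t" by (intro first_time_le) blast+
    next
      case False
      then have "ereal s \<le> ereal t" by simp
      with first_time_le[OF s hit'] show "first_time \<pi> f' C \<le> ereal t" by (rule order.trans)
    qed
  qed
  have hits: "C \<inter> (subgraph \<pi> f \<times> {0..s}) \<noteq> {}" "C \<inter> (subgraph \<pi> h \<times> {0..s}) \<noteq> {}"
    using hit by blast+
  have time: "first_time \<pi> f C = first_time \<pi> h C"
    using le[of f h] le[of h f] agree hits by (intro antisym) blast+
  \<comment> \<open>First points arrive no later than \<open>s\<close>, where the two subgraphs
    agree.\<close>
  have "ereal (snd z) \<le> first_time \<pi> h C \<Longrightarrow> snd z \<le> s" for z :: "('a \<times> real) \<times> real"
    using first_time_le[OF s hits(2)] by (metis ereal_less_eq(3) order.trans)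
  then have "first_points \<pi> f C = first_points \<pi> h C"
    unfolding first_points_def time using agree by (auto simp: mem_Times_iff)
  then show ?thesis unfolding first_x_def time by simp
qed

section \<open>Measure of subgraphs\<close>

lemma sets_subgraph_Int_Times:
  assumes [measurable]: "f \<in> borel_measurable \<pi>" "A \<in> sets \<pi>"
  shows "subgraph \<pi> f \<inter> A \<times> UNIV \<in> sets (\<pi> \<Otimes>\<^sub>M lborel_nonneg)"
proof -
  have "(\<lambda>y. y) \<in> borel_measurable lborel_nonneg"
    by (auto intro: measurable_restrict_space1)
  from measurable_compose[OF measurable_snd this]
  have [measurable]: "snd \<in> borel_measurable (\<pi> \<Otimes>\<^sub>M lborel_nonneg)" .
  have "subgraph \<pi> f \<inter> A \<times> UNIV
    = {z \<in> space (\<pi> \<Otimes>\<^sub>M lborel_nonneg). fst z \<in> A \<and> snd z \<le> f (fst z)}"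
    by (auto simp: subgraph_def space_pair_measure)
  also have "\<dots> \<in> sets (\<pi> \<Otimes>\<^sub>M lborel_nonneg)"
    by measurable
  finally show ?thesis .
qed

text \<open>By Fubini: the section over a point \<open>x\<close> of \<open>A\<close> is the interval
  from 0 to \<open>f x\<close>, of length \<open>f x\<close>.\<close>

lemma emeasure_subgraph_Int_Times:
  assumes "f \<in> borel_measurable \<pi>" "\<And>x. x \<in> space \<pi> \<Longrightarrow> 0 \<le> f x" "A \<in> sets \<pi>"
  shows "emeasure (\<pi> \<Otimes>\<^sub>M lborel_nonneg) (subgraph \<pi> f \<inter> A \<times> UNIV)
    = (\<integral>\<^sup>+x. ennreal (f x) * indicator A x \<partial>\<pi>)"
proof (subst sigma_finite_measure.emeasure_pair_measure_alt[OF sigma_finite_lborel_nonneg])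
  show "(\<integral>\<^sup>+x. emeasure lborel_nonneg (Pair x -` (subgraph \<pi> f \<inter> A \<times> UNIV)) \<partial>\<pi>)
    = (\<integral>\<^sup>+x. ennreal (f x) * indicator A x \<partial>\<pi>)"
  proof (rule nn_integral_cong)
    fix x assume x: "x \<in> space \<pi>"
    then have "Pair x -` (subgraph \<pi> f \<inter> A \<times> UNIV) = (if x \<in> A then {0..f x} else {})"
      by (auto simp: subgraph_def)
    then show "emeasure lborel_nonneg (Pair x -` (subgraph \<pi> f \<inter> A \<times> UNIV))
        = ennreal (f x) * indicator A x"
      using assms(2)[OF x] by (auto simp: emeasure_lborel_nonneg)
  qed
qed (rule sets_subgraph_Int_Times[OF assms(1,3)])

lemma subgraph_Int_space: "subgraph \<pi> f \<inter> space \<pi> \<times> UNIV = subgraph \<pi> f"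
  by (auto simp: subgraph_def)

text \<open>These regions compete in the coupling bound; seen as subgraphs, their measures become
  integrals of the minimum and the maximum.\<close>

lemma subgraph_min: "subgraph \<pi> (\<lambda>x. min (f x) (h x)) = subgraph \<pi> f \<inter> subgraph \<pi> h"
  and subgraph_max: "subgraph \<pi> (\<lambda>x. max (f x) (h x)) = subgraph \<pi> f \<union> subgraph \<pi> h"
  by (auto simp: subgraph_def)

lemma sets_subgraph:
  "f \<in> borel_measurable \<pi> \<Longrightarrow> subgraph \<pi> f \<in> sets (\<pi> \<Otimes>\<^sub>M lborel_nonneg)"
  using sets_subgraph_Int_Times[of f \<pi> "space \<pi>"] by (simp add: subgraph_Int_space)

lemma emeasure_subgraph:
  assumes "f \<in> borel_measurable \<pi>" "\<And>x. x \<in> space \<pi> \<Longrightarrow> 0 \<le> f x"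
  shows "emeasure (\<pi> \<Otimes>\<^sub>M lborel_nonneg) (subgraph \<pi> f) = (\<integral>\<^sup>+x. ennreal (f x) \<partial>\<pi>)"
proof -
  have "emeasure (\<pi> \<Otimes>\<^sub>M lborel_nonneg) (subgraph \<pi> f)
      = (\<integral>\<^sup>+x. ennreal (f x) * indicator (space \<pi>) x \<partial>\<pi>)"
    using emeasure_subgraph_Int_Times[OF assms sets.top] by (simp add: subgraph_Int_space)
  also have "\<dots> = (\<integral>\<^sup>+x. ennreal (f x) \<partial>\<pi>)"
    by (rule nn_integral_cong) simp
  finally show ?thesis .
qed

lemma has_density_integral:
  assumes "has_density \<pi> p f" "prob_space p"
  shows "integrable \<pi> f" and "integral\<^sup>L \<pi> f = 1"
proof -
  interpret p: prob_space p by fact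
  have f: "f \<in> borel_measurable \<pi>" "\<And>x. x \<in> space \<pi> \<Longrightarrow> 0 \<le> f x"
    and p: "p = density \<pi> (\<lambda>x. ennreal (f x))"
    using assms unfolding has_density_def by auto
  have "(\<integral>\<^sup>+x. ennreal (f x) \<partial>\<pi>) = (\<integral>\<^sup>+x. ennreal (f x) * indicator (space \<pi>) x \<partial>\<pi>)"
    by (rule nn_integral_cong) simp
  also have "\<dots> = emeasure p (space p)"
    using f by (simp add: p emeasure_density)
  finally have *: "(\<integral>\<^sup>+x. ennreal (f x) \<partial>\<pi>) = ennreal 1"
    using p.emeasure_space_1 by simp
  show "integrable \<pi> f"
    using * f by (intro integrableI_nonneg) auto
  show "integral\<^sup>L \<pi> f = 1"
    using * f by (subst integral_eq_nn_integral) auto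
qed

section \<open>Law of the first mark and the coupling bound\<close>

locale graph_poisson_process =
  fixes \<pi> :: "'a measure" and P :: "'w measure" and U :: "'w \<Rightarrow> (('a \<times> real) \<times> real) set"
  assumes poisson_intensity: "poisson_point_process P (intensity \<pi>) U"

text \<open>Marks are now the points (x, y); \<open>intensity\<close> is associated so that time is
  the last factor.\<close>

sublocale graph_poisson_process \<subseteq> timed_poisson_process P "\<pi> \<Otimes>\<^sub>M lborel_nonneg" U
  using poisson_intensity by unfold_locales (simp add: intensity_def)

context graph_poisson_process
begin

text \<open>Off a null set, X lies in \<open>A\<close> exactly when the part of the subgraph over
  \<open>A\<close> wins its race. That has probability at least p(A), for \<open>A\<close> and for
  its complement; as both sides sum to 1, equality follows.\<close>

lemma first_x_law:
  assumes dens: "has_density \<pi> p f" and p: "prob_space p"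
  shows "\<exists>X. X \<in> P \<rightarrow>\<^sub>M \<pi> \<and> distr P \<pi> X = p \<and> (AE \<omega> in P. first_x \<pi> f (U \<omega>) = Some (X \<omega>))"
proof -
  interpret p: prob_space p by fact
  have f: "f \<in> borel_measurable \<pi>" "\<And>x. x \<in> space \<pi> \<Longrightarrow> 0 \<le> f x"
    and p_def: "p = density \<pi> (\<lambda>x. ennreal (f x))"
    using dens unfolding has_density_def by auto
  let ?D = "subgraph \<pi> f"
  have slice: "?D \<inter> A \<times> UNIV \<in> sets (\<pi> \<Otimes>\<^sub>M lborel_nonneg)"
    "emeasure (\<pi> \<Otimes>\<^sub>M lborel_nonneg) (?D \<inter> A \<times> UNIV) = ennreal (p.prob A)" if "A \<in> sets \<pi>" for A
  proof -
    have "(\<integral>\<^sup>+x. ennreal (f x) * indicator A x \<partial>\<pi>) = emeasure p A"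
      using that f by (simp add: p_def emeasure_density)
    then show "?D \<inter> A \<times> UNIV \<in> sets (\<pi> \<Otimes>\<^sub>M lborel_nonneg)"
      "emeasure (\<pi> \<Otimes>\<^sub>M lborel_nonneg) (?D \<inter> A \<times> UNIV) = ennreal (p.prob A)"
      using that f
      by (simp_all add: sets_subgraph_Int_Times emeasure_subgraph_Int_Times p.emeasure_eq_measure)
  qed
  have compl: "?D - A \<times> UNIV = ?D \<inter> (space \<pi> - A) \<times> UNIV" for A
    by (auto simp: subgraph_def)
  have p_compl: "p.prob (space \<pi> - A) = 1 - p.prob A" if "A \<in> sets \<pi>" for A
    using p.prob_compl[of A] that by (simp add: p_def)
  define R where "R A = {\<omega> \<in> space P. precedes (U \<omega>) (?D \<inter> A \<times> UNIV) (?D - A \<times> UNIV)}" for A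
  have R: "R A \<in> events" if "A \<in> sets \<pi>" for A
    unfolding R_def compl using that by (auto intro!: pred_precedes[unfolded pred_def] slice)
  have prob_R: "p.prob A \<le> prob (R A)" if "A \<in> sets \<pi>" for A
  proof -
    \<comment> \<open>The two competing parts have intensities p(A) and 1 - p(A), so the denominator
      is 1.\<close>
    have "p.prob A / (p.prob A + p.prob (space \<pi> - A)) \<le> prob (R A)"
      unfolding R_def compl using that
      by (intro prob_precedes_ge slice) (auto simp: p_compl)
    with that show ?thesis by (simp add: p_compl)
  qed
  have "AE \<omega> in P. well_timed (U \<omega>) ?D"
    using slice[of "space \<pi>"] p.prob_space
    by (intro AE_well_timed[where d=1]) (auto simp: subgraph_Int_space p_def)
  \<comment> \<open>The exceptional set is enclosed in a measurable null set \<open>Z\<close>, on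
    which \<open>X\<close> gets the default value \<open>x0\<close>; this makes \<open>X\<close>
    total and measurable.\<close>
  then obtain Z where Z: "{\<omega> \<in> space P. \<not> well_timed (U \<omega>) ?D} \<subseteq> Z" "emeasure P Z = 0" "Z \<in> events"
    by (rule AE_E)
  obtain x0 where x0: "x0 \<in> space \<pi>"
    using p.not_empty by (auto simp: p_def)
  define X where "X \<omega> = (if \<omega> \<in> Z then x0 else the (first_x \<pi> f (U \<omega>)))" for \<omega>
  have X: "first_x \<pi> f (U \<omega>) = Some (X \<omega>)" "X \<omega> \<in> space \<pi>" "\<And>A. X \<omega> \<in> A \<longleftrightarrow> \<omega> \<in> R A"
    if \<omega>: "\<omega> \<in> space P" "\<omega> \<notin> Z" for \<omega>
  proof -
    have "well_timed (U \<omega>) ?D" using Z \<omega> by blast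
    from first_x_well_timed[OF this] obtain x where x: "x \<in> space \<pi>" "first_x \<pi> f (U \<omega>) = Some x"
      and xA: "\<And>A. x \<in> A \<longleftrightarrow> precedes (U \<omega>) (?D \<inter> A \<times> UNIV) (?D - A \<times> UNIV)"
      by blast
    have "X \<omega> = x" using \<omega> x by (simp add: X_def)
    then show "first_x \<pi> f (U \<omega>) = Some (X \<omega>)" "X \<omega> \<in> space \<pi>" "\<And>A. X \<omega> \<in> A \<longleftrightarrow> \<omega> \<in> R A"
      using x \<omega> xA unfolding R_def by simp_all
  qed
  have vimage: "X -` A \<inter> space P = (R A - Z) \<union> (if x0 \<in> A then Z else {})" for A
  proof (intro set_eqI)
    fix \<omega>
    have "R A \<subseteq> space P" "Z \<subseteq> space P"
      using sets.sets_into_space[OF Z(3)] by (auto simp: R_def)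
    then show "\<omega> \<in> X -` A \<inter> space P \<longleftrightarrow> \<omega> \<in> (R A - Z) \<union> (if x0 \<in> A then Z else {})"
      using X(3)[of \<omega> A] by (cases "\<omega> \<in> Z"; cases "\<omega> \<in> space P") (auto simp: X_def)
  qed
  have X_meas: "X \<in> P \<rightarrow>\<^sub>M \<pi>"
  proof (rule measurableI)
    show "X \<omega> \<in> space \<pi>" if "\<omega> \<in> space P" for \<omega>
      using X(2)[OF that] x0 by (cases "\<omega> \<in> Z") (auto simp: X_def)
    show "X -` A \<inter> space P \<in> events" if "A \<in> sets \<pi>" for A
      unfolding vimage using R[OF that] Z by auto
  qed
  have AE_X: "AE \<omega> in P. first_x \<pi> f (U \<omega>) = Some (X \<omega>)"
    using X(1) Z by (intro AE_I[of _ _ Z]) auto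
  have ge: "p.prob A \<le> prob (X -` A \<inter> space P)" if A: "A \<in> sets \<pi>" for A
  proof -
    have "prob (R A) = prob (R A - Z)"
      using R[OF A] Z by (simp add: measure_Diff_null_set null_sets_def)
    also have "\<dots> \<le> prob (X -` A \<inter> space P)"
      using measurable_sets[OF X_meas A] by (intro finite_measure_mono) (auto simp: vimage)
    finally show ?thesis using prob_R[OF A] by simp
  qed
  have "distr P \<pi> X = p"
  proof (rule measure_eqI)
    fix A assume "A \<in> sets (distr P \<pi> X)"
    then have A: "A \<in> sets \<pi>" by simp
    have "X -` (space \<pi> - A) \<inter> space P = space P - (X -` A \<inter> space P)"
      using measurable_space[OF X_meas] by auto
    then have "prob (X -` (space \<pi> - A) \<inter> space P) = 1 - prob (X -` A \<inter> space P)"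
      using measurable_sets[OF X_meas A] by (simp only: prob_compl)
    \<comment> \<open>The bound for \<open>A\<close> is a lower bound, and the bound for the
      complement is an upper bound, on the same probability.\<close>
    with ge[OF A] ge[of "space \<pi> - A"] A have "prob (X -` A \<inter> space P) = p.prob A"
      by (auto simp: p_compl)
    then show "emeasure (distr P \<pi> X) A = emeasure p A"
      using A X_meas by (simp add: emeasure_distr emeasure_eq_measure p.emeasure_eq_measure)
  qed (simp add: p_def)
  with X_meas AE_X show ?thesis by blast
qed

text \<open>The intersection of the subgraphs has measure 1 - d and the symmetric difference 2 d, so
  the former wins the race with probability at least (1 - d) / (1 + d). The complementary
  probability is at most 2 d / (1 + d).\<close>

lemma prob_first_x_neq_le:
  assumes p: "has_density \<pi> p f" "prob_space p" and q: "has_density \<pi> q h" "prob_space q"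
  shows "outer_measure_of P {\<omega> \<in> space P. first_x \<pi> f (U \<omega>) \<noteq> first_x \<pi> h (U \<omega>)}
    \<le> ennreal (2 * tv_dist \<pi> f h / (1 + tv_dist \<pi> f h))"
proof -
  define d where "d = tv_dist \<pi> f h"
  have f: "f \<in> borel_measurable \<pi>" "\<And>x. x \<in> space \<pi> \<Longrightarrow> 0 \<le> f x"
    and h: "h \<in> borel_measurable \<pi>" "\<And>x. x \<in> space \<pi> \<Longrightarrow> 0 \<le> h x"
    using p q unfolding has_density_def by auto
  note int = has_density_integral[OF p] has_density_integral[OF q]
  let ?N = "\<pi> \<Otimes>\<^sub>M lborel_nonneg"
  let ?I = "subgraph \<pi> f \<inter> subgraph \<pi> h" and ?V = "subgraph \<pi> f \<union> subgraph \<pi> h"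
  have d0: "0 \<le> d" by (simp add: d_def tv_dist_def)
  \<comment> \<open>Minimum and maximum are half of f + h \<mp> |f - h|, with f and h of integral
    1.\<close>
  have "(\<integral>x. min (f x) (h x) \<partial>\<pi>) = (\<integral>x. (f x + h x - \<bar>f x - h x\<bar>) / 2 \<partial>\<pi>)"
    by (rule Bochner_Integration.integral_cong) (auto simp: min_def)
  also have "\<dots> = 1 - d"
    using int by (simp add: d_def tv_dist_def)
  finally have min: "(\<integral>x. min (f x) (h x) \<partial>\<pi>) = 1 - d" .
  have "(\<integral>x. max (f x) (h x) \<partial>\<pi>) = (\<integral>x. (f x + h x + \<bar>f x - h x\<bar>) / 2 \<partial>\<pi>)"
    by (rule Bochner_Integration.integral_cong) (auto simp: max_def)
  also have "\<dots> = 1 + d"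
    using int by (simp add: d_def tv_dist_def)
  finally have max: "(\<integral>x. max (f x) (h x) \<partial>\<pi>) = 1 + d" .
  have I: "?I \<in> sets ?N" "emeasure ?N ?I = ennreal (1 - d)"
    using f h int
    by (simp_all add: subgraph_min[symmetric] sets_subgraph emeasure_subgraph nn_integral_eq_integral
        flip: min)
  have V: "?V \<in> sets ?N" "emeasure ?N ?V = ennreal (1 + d)"
    using f h int
    by (simp_all add: subgraph_max[symmetric] sets_subgraph emeasure_subgraph nn_integral_eq_integral
        le_max_iff_disj flip: max)
  \<comment> \<open>The bound d \<le> 1 comes from nonnegativity of the minimum.\<close>
  have d1: "0 \<le> 1 - d"
    unfolding min[symmetric] using f h by (intro integral_nonneg_AE) auto
  have "emeasure ?N (?V - ?I) = emeasure ?N ?V - emeasure ?N ?I"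
    using I V by (intro emeasure_Diff) auto
  also have "\<dots> = ennreal (2 * d)"
    unfolding I V using d1 by (simp add: ennreal_minus)
  finally have VI: "emeasure ?N (?V - ?I) = ennreal (2 * d)" .
  define R where "R = {\<omega> \<in> space P. precedes (U \<omega>) ?I (?V - ?I)}"
  have R: "R \<in> events"
    unfolding R_def using I V by (auto intro!: pred_precedes[unfolded pred_def])
  have "(1 - d) / (1 - d + 2 * d) \<le> prob R"
    unfolding R_def using I V VI d0 d1 by (intro prob_precedes_ge) auto
  then have "1 - prob R \<le> 2 * d / (1 + d)"
    using d0 by (simp add: field_simps)
  \<comment> \<open>The set on the left may fail to be measurable, so it is enclosed in the event
    that the race is not won.\<close>
  have "{\<omega> \<in> space P. first_x \<pi> f (U \<omega>) \<noteq> first_x \<pi> h (U \<omega>)} \<subseteq> space P - R"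
    using first_x_eq_of_precedes by (auto simp: R_def)
  then have "outer_measure_of P {\<omega> \<in> space P. first_x \<pi> f (U \<omega>) \<noteq> first_x \<pi> h (U \<omega>)}
      \<le> outer_measure_of P (space P - R)"
    by (rule outer_measure_of_mono)
  also have "\<dots> = ennreal (1 - prob R)"
    using R by (simp add: emeasure_eq_measure prob_compl)
  also have "\<dots> \<le> ennreal (2 * d / (1 + d))"
    by (rule ennreal_leI) fact
  finally show ?thesis by (simp add: d_def)
qed

end

(* The measurable space (E, EE) is not assumed to have a measurable diagonal, so the event
   g(U,p) ~= g(U,q) need not be measurable; its probability is therefore taken as an outer
   probability, which agrees with P whenever the event is measurable. *)
theorem proposition1p3:
  fixes \<pi> :: "'a measure" and P :: "'w measure"
    and U :: "'w \<Rightarrow> (('a \<times> real) \<times> real) set"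
    and f :: "'a measure \<Rightarrow> 'a \<Rightarrow> real"
    and g :: "(('a \<times> real) \<times> real) set \<Rightarrow> 'a measure \<Rightarrow> 'a option"
  assumes "sigma_finite_measure \<pi>"
    and "poisson_point_process P (intensity \<pi>) U"
    and "\<And>p. p \<in> density_laws \<pi> \<Longrightarrow> has_density \<pi> p (f p)"
  defines "g \<equiv> \<lambda>C p. first_x \<pi> (f p) C"
  shows "global_coupling P (configurations (intensity \<pi>)) \<pi> (density_laws \<pi>) U g \<and>
    (\<forall>p\<in>density_laws \<pi>. \<forall>q\<in>density_laws \<pi>.
       outer_measure_of P {\<omega> \<in> space P. g (U \<omega>) p \<noteq> g (U \<omega>) q}
         \<le> ennreal (2 * tv_dist \<pi> (f p) (f q) / (1 + tv_dist \<pi> (f p) (f q))) \<and>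
       2 * tv_dist \<pi> (f p) (f q) / (1 + tv_dist \<pi> (f p) (f q)) \<le> 2 * tv_dist \<pi> (f p) (f q))"
proof -
  interpret graph_poisson_process \<pi> P U
    by unfold_locales fact
  have law: "has_density \<pi> p (f p)" "prob_space p" if "p \<in> density_laws \<pi>" for p
    using that assms(3) by (auto simp: density_laws_def)
  have "global_coupling P (configurations (intensity \<pi>)) \<pi> (density_laws \<pi>) U g"
    unfolding global_coupling_def g_def
    using prob_space_axioms measurable_process first_x_law[OF law] by (simp add: intensity_def)
  moreover have "2 * d / (1 + d) \<le> 2 * d" if "0 \<le> d" for d :: real
    using that by (simp add: divide_le_eq algebra_simps)
  moreover have "0 \<le> tv_dist \<pi> (f p) (f q)" for p q
    by (simp add: tv_dist_def)
  ultimately show ?thesis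
    using prob_first_x_neq_le[OF law law] by (simp add: g_def)
qed

end
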